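(* Let $$\gamma_0=\min\Big\{ \inf_{\omega\in\mathbb{R}} \Re \frac{g_{i_1 j_1}(j\omega)}{f_{i_2 j_2}(j\omega)} : (i_1\, j_1\, i_2\, j_2) \in I_3 \Big\},\qquad \gamma_1=\inf\Big\{ \inf_{\omega\in\mathbb{R}} \Re \frac{g(j\omega)}{f(j\omega)} : g(s)\in K^m(s),\ f(s)\in K^n(s) \Big\}.$$ If $f_{ik}(s)\in H$ for all $i,k\in\{1,2\}$, then: 1) if $\gamma_0<0$, then $\gamma_1=\gamma_0<0$; 2) if $\gamma_0=0$, then $\gamma_1=0$; 3) if $\gamma_0>0$, then $\gamma_1\ge 0$.
   Context: $j$ (not as a subscript) is the imaginary unit. $H$ is the set of Hurwitz stable polynomials (all zeros in the open left half plane). Let $m\le n$, and let real numbers $a_i^-\le a_i^+$ ($0\le i\le m$), $b_i^-\le b_i^+$ ($0\le i\le n$) be given. The $m$-th and $n$-th order real interval polynomials are $$K^m(s)=\Big\{\sum_{i=0}^m a_i s^i : a_i\in[a_i^-,a_i^+]\Big\},\qquad K^n(s)=\Big\{\sum_{i=0}^n b_i s^i : b_i\in[b_i^-,b_i^+]\Big\},$$ where all members of $K^n(s)$ have order exactly $n$, i.e. $0\notin[b_n^-,b_n^+]$. Define (sums truncated at degree $m$) $\alpha_g^{(1)}(s^2)=a_0^-+a_2^+s^2+a_4^-s^4+a_6^+s^6+\cdots$, $\alpha_g^{(2)}(s^2)=a_0^++a_2^-s^2+a_4^+s^4+a_6^-s^6+\cdots$, $\beta_g^{(1)}(s^2)=a_1^-+a_3^+s^2+a_5^-s^4+a_7^+s^6+\cdots$,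 $\beta_g^{(2)}(s^2)=a_1^++a_3^-s^2+a_5^+s^4+a_7^-s^6+\cdots$, and $g_{ik}(s)=\alpha_g^{(i)}(s^2)+s\,\beta_g^{(k)}(s^2)\in K^m(s)$ for $i,k\in\{1,2\}$. The polynomials $f_{ik}(s)\in K^n(s)$ are defined in the same way from the bounds $b_i^\pm$. The index set is $I_3=\{(1111),(1212),(2222),(2121),(1112),(1222),(2221),(2111),(1211),(2212),(2122),(1121)\}$, where $(i_1\,j_1\,i_2\,j_2)$ is a 4-tuple with entries in $\{1,2\}$. *)

theory Defs
  imports Complex_Main "HOL-Computational_Algebra.Polynomial" "HOL-Library.Extended_Real"
begin

definition cpoly :: "real poly \<Rightarrow> complex \<Rightarrow> complex" where
  "cpoly p s = poly (map_poly complex_of_real p) s"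

definition hurwitz :: "real poly \<Rightarrow> bool" where
  "hurwitz p \<longleftrightarrow> (\<forall>s. cpoly p s = 0 \<longrightarrow> Re s < 0)"

definition interval_polys :: "nat \<Rightarrow> (nat \<Rightarrow> real) \<Rightarrow> (nat \<Rightarrow> real) \<Rightarrow> real poly set" where
  "interval_polys d l u = {\<Sum>i\<le>d. monom (c i) i | c. \<forall>i\<le>d. c i \<in> {l i..u i}}"

(* Polynomials in the variable x = s^2.  For i = 1 the coefficients alternate as
   lower, upper, lower, ...; for i = 2 as upper, lower, upper, ... *)

definition kh_alpha :: "nat \<Rightarrow> (nat \<Rightarrow> real) \<Rightarrow> (nat \<Rightarrow> real) \<Rightarrow> nat \<Rightarrow> real poly" where
  "kh_alpha d l u i =
     (\<Sum>k | 2 * k \<le> d. monom (if i = 1 \<longleftrightarrow> even k then l (2 * k) else u (2 * k)) k)"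

definition kh_beta :: "nat \<Rightarrow> (nat \<Rightarrow> real) \<Rightarrow> (nat \<Rightarrow> real) \<Rightarrow> nat \<Rightarrow> real poly" where
  "kh_beta d l u i =
     (\<Sum>k | 2 * k + 1 \<le> d. monom (if i = 1 \<longleftrightarrow> even k then l (2 * k + 1) else u (2 * k + 1)) k)"

definition kharitonov ::
    "nat \<Rightarrow> (nat \<Rightarrow> real) \<Rightarrow> (nat \<Rightarrow> real) \<Rightarrow> nat \<Rightarrow> nat \<Rightarrow> real poly" where
  "kharitonov d l u i k =
     pcompose (kh_alpha d l u i) (monom 1 2) + monom 1 1 * pcompose (kh_beta d l u k) (monom 1 2)"

definition I3 :: "(nat \<times> nat \<times> nat \<times> nat) set" where
  "I3 = {(1,1,1,1), (1,2,1,2), (2,2,2,2), (2,1,2,1),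
         (1,1,1,2), (1,2,2,2), (2,2,2,1), (2,1,1,1),
         (1,2,1,1), (2,2,1,2), (2,1,2,2), (1,1,2,1)}"

(* The infima are taken in the extended reals, so that an infimum of a set not
   bounded below is -\<infinity> and not an unspecified real number. *)

definition inf_Re :: "real poly \<Rightarrow> real poly \<Rightarrow> ereal" where
  "inf_Re g f =
     (INF \<omega>::real. ereal (Re (cpoly g (\<i> * of_real \<omega>) / cpoly f (\<i> * of_real \<omega>))))"

definition gamma0 ::
    "nat \<Rightarrow> nat \<Rightarrow> (nat \<Rightarrow> real) \<Rightarrow> (nat \<Rightarrow> real) \<Rightarrow> (nat \<Rightarrow> real) \<Rightarrow> (nat \<Rightarrow> real) \<Rightarrow> ereal" where
  "gamma0 m n al au bl bu =
     Min {inf_Re (kharitonov m al au i1 j1) (kharitonov n bl bu i2 j2) | i1 j1 i2 j2.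
            (i1, j1, i2, j2) \<in> I3}"

definition gamma1 ::
    "nat \<Rightarrow> nat \<Rightarrow> (nat \<Rightarrow> real) \<Rightarrow> (nat \<Rightarrow> real) \<Rightarrow> (nat \<Rightarrow> real) \<Rightarrow> (nat \<Rightarrow> real) \<Rightarrow> ereal" where
  "gamma1 m n al au bl bu =
     Inf {inf_Re g f | g f. g \<in> interval_polys m al au \<and> f \<in> interval_polys n bl bu}"

end

theory Submission
  imports Defs "HOL-Complex_Analysis.Conformal_Mappings"
    "HOL-Computational_Algebra.Fundamental_Theorem_Algebra"
begin

text \<open>
  Since the Kharitonov polynomials belong to the interval families, the infimum \<open>\<gamma>\<^sub>1\<close> is at most
  \<open>\<gamma>\<^sub>0\<close>.  All three claims therefore follow from one lower bound: if \<open>\<gamma> \<le> 0\<close> is a lower bound for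
  the twelve vertex ratios on the whole imaginary axis, then it is a lower bound for every ratio
  \<open>g / f\<close> of members.

  At a fixed frequency \<open>\<omega> \<ge> 0\<close> the values of the members of an interval family lie in a rectangle
  parallel to the axes whose corners are the values of the four Kharitonov polynomials, so it
  suffices to bound \<open>Re (g / f)\<close> for \<open>g\<close> and \<open>f\<close> in two rectangles.  The rectangle of the denominators
  omits the origin (Kharitonov's theorem), hence the minimum is attained at some pair \<open>(g, f)\<close>.
  Suppose that it is smaller than \<open>\<gamma>\<close>, and put \<open>z = - g / f\<close>, so that \<open>g + z f = 0\<close> and
  \<open>Re z > - \<gamma> \<ge> 0\<close>.  The first order conditions (\<open>ratio_minimum_first_order\<close>) say that \<open>g\<close> is
  extremal in its rectangle in the direction \<open>f\<close>, and \<open>f\<close> is extremal in its own rectangle in the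
  direction \<open>w = cnj z * f\<close>.  As \<open>Re z > 0\<close>, the directions \<open>f\<close> and \<open>w\<close> enclose an acute angle.
  Therefore the two extremal corners are never opposite to each other, and the pairs of
  non-opposite corners are exactly the elements of \<open>I3\<close>.

  Let \<open>p = g\<^sub>v + z f\<^sub>v\<close> be the combination of Kharitonov polynomials that belongs to an index in
  \<open>I3\<close>.  On the imaginary axis \<open>p / f\<^sub>v = g\<^sub>v / f\<^sub>v + z\<close> has real part at least \<open>\<gamma> + Re z > 0\<close>.  By the
  maximum principle this also holds in the right half plane, so \<open>p\<close> is a stable polynomial
  (\<open>stable_if_Re_quotient_pos\<close>).  If the extremal corners are unique, some \<open>p\<close> vanishes at
  \<open>\<i> \<omega>\<close>, which is absurd.  Otherwise the origin lies on a segment between the values at \<open>\<i> \<omega>\<close> of two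
  such polynomials whose difference has a constant direction along the imaginary axis.  This
  is impossible as well, because the argument of a stable polynomial strictly increases along
  the axis: the two end points would leave the line of the segment on opposite sides
  (\<open>moving_edge_avoids_origin\<close>).  The same lemma proves Kharitonov's theorem.  It needs
  polynomials that are not constant, so \<open>n = 0\<close> is treated by elementary arithmetic.
\<close>

section \<open>Stable complex polynomials on the imaginary axis\<close>

definition stable_poly :: "complex poly \<Rightarrow> bool" where
  "stable_poly p \<longleftrightarrow> (\<forall>s. poly p s = 0 \<longrightarrow> Re s < 0)"

abbreviation cx :: "real poly \<Rightarrow> complex poly" where
  "cx \<equiv> map_poly complex_of_real"

lemma stable_nonzero: "stable_poly p \<Longrightarrow> Re s \<ge> 0 \<Longrightarrow> poly p s \<noteq> 0"
  by (auto simp: stable_poly_def)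

text \<open>
  The logarithmic derivative is the sum of \<open>1 / (s - a)\<close> over the zeros \<open>a\<close>, and each summand has
  positive real part.  On the imaginary axis the real part is the derivative of the argument.
\<close>

lemma Re_log_deriv_pos:
  assumes "stable_poly p" and "degree p > 0" and s: "Re s \<ge> 0"
  shows "Re (poly (pderiv p) s / poly p s) > 0"
  using assms(1,2)
proof (induction "degree p" arbitrary: p rule: less_induct)
  case less
  obtain a where a: "poly p a = 0"
    using less.prems(2) fundamental_theorem_of_algebra[of p] by (auto simp: constant_degree)
  then obtain q where p: "p = [:-a, 1:] * q"
    by (auto simp: poly_eq_0_iff_dvd)
  have "p \<noteq> 0" using less.prems(2) by auto
  then have "q \<noteq> 0" using p by auto
  then have deg: "degree p = Suc (degree q)"
    unfolding p by (subst degree_mult_eq) auto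
  have q: "stable_poly q" using less.prems(1) by (auto simp: stable_poly_def p)
  have "Re a < 0" using a less.prems(1) by (auto simp: stable_poly_def)
  then have pos: "Re (s - a) > 0" using s by simp
  then have "s \<noteq> a" by auto
  have qs: "poly q s \<noteq> 0" using stable_nonzero[OF q s] .
  have "poly (pderiv p) s / poly p s = 1 / (s - a) + poly (pderiv q) s / poly q s"
    using \<open>s \<noteq> a\<close> qs unfolding p pderiv_mult
    by (simp add: pderiv_pCons divide_simps) (simp add: algebra_simps)
  moreover have "Re (1 / (s - a)) > 0"
    using pos \<open>s \<noteq> a\<close> by (simp add: Re_divide complex_eq_iff sum_power2_gt_zero_iff)
  moreover have "Re (poly (pderiv q) s / poly q s) \<ge> 0"
  proof (cases "degree q = 0")
    case True
    then have "pderiv q = 0" by (simp add: pderiv_eq_0_iff)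
    then show ?thesis by simp
  next
    case False
    then show ?thesis using less.hyps[of q] deg q by simp
  qed
  ultimately show ?case by simp
qed

lemma Re_of_real_mult: "Re (of_real x * z) = x * Re z" for z :: complex
  by simp

text \<open>
  The segment between the values of \<open>p\<close> and \<open>q\<close> keeps the direction \<open>d\<close>, so \<open>Im (p / d)\<close> and
  \<open>Im (q / d)\<close> are the same function of \<open>\<omega>\<close>.  If the origin lay on the segment, this function would
  vanish at \<open>\<omega>\<^sub>0\<close> while \<open>p / d\<close> is negative and \<open>q / d\<close> is positive there.  Increasing arguments then
  force its derivative to be negative because of \<open>p\<close> and positive because of \<open>q\<close>.
\<close>

lemma moving_edge_avoids_origin:
  fixes d :: complex and r :: "real \<Rightarrow> real"
  assumes stable: "stable_poly p" "stable_poly q" and deg: "degree p > 0" "degree q > 0" and "d \<noteq> 0"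
    and diff: "\<And>\<omega>::real. poly q (\<i> * \<omega>) = poly p (\<i> * \<omega>) + d * of_real (r \<omega>)"
    and start: "poly p (\<i> * of_real \<omega>\<^sub>0) = d * of_real a"
    and sgn: "a \<le> 0" "0 \<le> a + r \<omega>\<^sub>0"
  shows False
proof -
  have edge: "Im (poly p (\<i> * of_real \<omega>) / d) = Im (poly q (\<i> * of_real \<omega>) / d)" for \<omega>
    using \<open>d \<noteq> 0\<close> by (simp add: diff add_divide_distrib)
  have line: "Im (poly p (\<i> * of_real \<omega>\<^sub>0) / d) = 0"
    and p: "Re (poly p (\<i> * of_real \<omega>\<^sub>0) / d) \<le> 0"
    and q: "Re (poly q (\<i> * of_real \<omega>\<^sub>0) / d) \<ge> 0"
    using \<open>d \<noteq> 0\<close> sgn by (simp_all add: diff start add_divide_distrib)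
  let ?s = "\<i> * complex_of_real \<omega>\<^sub>0"
  have deriv: "((\<lambda>\<omega>. Im (poly r (\<i> * of_real \<omega>) / d)) has_real_derivative
      Re (poly (pderiv r) ?s / d)) (at \<omega>\<^sub>0)" for r
  proof -
    have "((\<lambda>z. poly r (\<i> * z) / d) has_field_derivative poly (pderiv r) ?s * \<i> / d) (at (of_real \<omega>\<^sub>0))"
    proof -
      have "((\<lambda>z. poly r (\<i> * z)) has_field_derivative poly (pderiv r) ?s * \<i>) (at (of_real \<omega>\<^sub>0))"
        by (rule DERIV_chain'[OF _ poly_DERIV]) (auto intro!: derivative_eq_intros)
      then show ?thesis by (rule DERIV_cdivide)
    qed
    then have "((\<lambda>\<omega>. poly r (\<i> * of_real \<omega>) / d) has_vector_derivative
        poly (pderiv r) ?s * \<i> / d) (at \<omega>\<^sub>0)"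
      by (rule has_vector_derivative_real_field)
    then have "((\<lambda>\<omega>. Im (poly r (\<i> * of_real \<omega>) / d)) has_vector_derivative
        Im (poly (pderiv r) ?s * \<i> / d)) (at \<omega>\<^sub>0)"
      by (rule bounded_linear.has_vector_derivative[OF bounded_linear_Im])
    moreover have "Im (poly (pderiv r) ?s * \<i> / d) = Re (poly (pderiv r) ?s / d)"
      by (simp add: Im_divide Re_divide)
    ultimately show ?thesis by (simp add: has_real_derivative_iff_has_vector_derivative)
  qed
  have eq_deriv: "Re (poly (pderiv p) ?s / d) = Re (poly (pderiv q) ?s / d)"
    using DERIV_unique[OF deriv[of p]] deriv[of q] edge by simp
  have factor: "Re (poly (pderiv r) ?s / d) = Re (poly r ?s / d) * Re (poly (pderiv r) ?s / poly r ?s)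
      \<and> Re (poly r ?s / d) \<noteq> 0"
    if "stable_poly r" and "Im (poly r ?s / d) = 0" for r
  proof -
    have nz: "poly r ?s \<noteq> 0" by (rule stable_nonzero[OF that(1)]) simp
    then have eq: "poly (pderiv r) ?s / d = (poly r ?s / d) * (poly (pderiv r) ?s / poly r ?s)"
      by simp
    have real: "poly r ?s / d = of_real (Re (poly r ?s / d))"
      using that(2) by (simp add: complex_eq_iff)
    have "poly r ?s / d \<noteq> 0" using nz \<open>d \<noteq> 0\<close> by simp
    then have "Re (poly r ?s / d) \<noteq> 0" using that(2) by (auto simp: complex_eq_iff)
    moreover have "Re (poly (pderiv r) ?s / d) = Re (of_real (Re (poly r ?s / d)) * (poly (pderiv r) ?s / poly r ?s))"
      using eq real by metis
    ultimately show ?thesis using Re_of_real_mult by metis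
  qed
  moreover have "Re (poly (pderiv p) ?s / poly p ?s) > 0" "Re (poly (pderiv q) ?s / poly q ?s) > 0"
    using Re_log_deriv_pos stable deg by simp_all
  ultimately have "Re (poly (pderiv p) ?s / d) < 0" "Re (poly (pderiv q) ?s / d) > 0"
    using factor[OF stable(1) line] factor[OF stable(2)] p q line edge[of \<omega>\<^sub>0]
    by (simp_all add: mult_neg_pos)
  then show False using eq_deriv by simp
qed

lemma poly_quotient_tendsto_at_infinity:
  fixes p q :: "complex poly"
  assumes "degree p \<le> degree q"
  shows "((\<lambda>s. poly p s / poly q s) \<longlongrightarrow> coeff p (degree q) / lead_coeff q) at_infinity"
proof (cases "q = 0")
  case False
  have num: "((\<lambda>s. poly p s / s ^ degree q) \<longlongrightarrow> coeff p (degree q)) at_infinity"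
  proof (cases "degree p = degree q")
    case True
    then show ?thesis using poly_divide_tendsto_aux[of p] by simp
  next
    case False
    then have lt: "degree p < degree q" using assms by simp
    then have "((\<lambda>s. poly p s / poly (monom 1 (degree q)) s) \<longlongrightarrow> 0) at_infinity"
      by (intro poly_divide_tendsto_0_at_infinity) (simp add: degree_monom_eq)
    then show ?thesis using lt by (simp add: poly_monom coeff_eq_0)
  qed
  have "((\<lambda>s. (poly p s / s ^ degree q) / (poly q s / s ^ degree q)) \<longlongrightarrow>
      coeff p (degree q) / lead_coeff q) at_infinity"
    using False by (intro tendsto_divide num poly_divide_tendsto_aux) auto
  moreover have "eventually (\<lambda>s::complex. s \<noteq> 0) at_infinity"
    by (auto simp: eventually_at_infinity intro!: exI[of _ 1])
  then have "eventually (\<lambda>s. (poly p s / s ^ degree q) / (poly q s / s ^ degree q) = poly p s / poly q s) at_infinity"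
    by (rule eventually_mono) simp
  ultimately show ?thesis by (rule Lim_transform_eventually)
qed auto

lemma imaginary_axis_at_infinity: "filterlim (\<lambda>\<omega>::real. \<i> * complex_of_real \<omega>) at_infinity at_top"
  by (rule filterlim_norm_at_top_imp_at_infinity)
    (simp add: norm_mult filterlim_abs_real)

text \<open>
  The maximum principle for \<open>- Re (p / f)\<close> on a large half disc: the diameter is controlled by the
  hypothesis, and the arc by the limit of \<open>p / f\<close> at infinity, which is finite because the
  quotient is proper and which inherits the bound because it is also the limit along the
  imaginary axis.
\<close>

lemma Re_quotient_lower_bound_right_half_plane:
  assumes f: "stable_poly f" and deg: "degree p \<le> degree f"
    and axis: "\<And>\<omega>::real. Re (poly p (\<i> * \<omega>) / poly f (\<i> * \<omega>)) \<ge> e"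
  shows "Re (coeff p (degree f) / lead_coeff f) \<ge> e"
    and "Re s \<ge> 0 \<Longrightarrow> Re (poly p s / poly f s) \<ge> e"
proof -
  let ?q = "\<lambda>s. poly p s / poly f s"
  note lim = poly_quotient_tendsto_at_infinity[OF deg]
  have "((\<lambda>\<omega>::real. Re (?q (\<i> * \<omega>))) \<longlongrightarrow> Re (coeff p (degree f) / lead_coeff f)) at_top"
    by (intro tendsto_Re filterlim_compose[OF lim imaginary_axis_at_infinity])
  then show L: "Re (coeff p (degree f) / lead_coeff f) \<ge> e"
    using axis by (intro tendsto_lowerbound) auto
  assume s: "Re s \<ge> 0"
  show "Re (?q s) \<ge> e"
  proof (rule field_le_epsilon)
    fix \<delta> :: real assume "\<delta> > 0"
    then have "eventually (\<lambda>s. Re (?q s) > e - \<delta>) at_infinity"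
      using L by (intro order_tendstoD(1)[OF tendsto_Re[OF lim]]) simp
    then obtain R where R: "\<And>s. norm s \<ge> R \<Longrightarrow> Re (?q s) > e - \<delta>"
      by (auto simp: eventually_at_infinity)
    define S where "S = cball 0 (max R (norm s)) \<inter> {s. Re s \<ge> 0}"
    have closed: "closed S" unfolding S_def by (intro closed_Int closed_cball closed_halfspace_Re_ge)
    have nz: "poly f z \<noteq> 0" if "z \<in> S" for z
      using that stable_nonzero[OF f] by (auto simp: S_def)
    have "frontier S \<subseteq> S" using closed by (simp add: frontier_subset_closed)
    have fr: "- Re (?q z) \<le> \<delta> - e" if z: "z \<in> frontier S" for z
    proof (cases "Re z = 0")
      case True
      then have z: "\<i> * of_real (Im z) = z" by (simp add: complex_eq_iff)
      then show ?thesis using axis[of "Im z", unfolded z] \<open>\<delta> > 0\<close> by simp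
    next
      case False
      have "z \<in> S" using z \<open>frontier S \<subseteq> S\<close> by auto
      with False have "Re z > 0" by (simp add: S_def)
      have "\<not> norm z < max R (norm s)"
      proof
        assume "norm z < max R (norm s)"
        with \<open>Re z > 0\<close> have "z \<in> ball 0 (max R (norm s)) \<inter> {s. Re s > 0}" by simp
        moreover have "open (ball (0::complex) (max R (norm s)) \<inter> {s. Re s > 0})"
          by (intro open_Int open_ball open_halfspace_Re_gt)
        moreover have "ball (0::complex) (max R (norm s)) \<inter> {s. Re s > 0} \<subseteq> S"
          by (auto simp: S_def)
        ultimately have "z \<in> interior S" by (meson interiorI)
        then show False using z by (simp add: frontier_def)
      qed
      then show ?thesis using R[of z] max.cobounded1[of R "norm s"] by linarith
    qed
    have "Re (- ?q s) \<le> \<delta> - e"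
    proof (rule maximum_real_frontier[where S = S and f = "\<lambda>s. - ?q s"])
      show "(\<lambda>s. - ?q s) holomorphic_on interior S"
        using nz interior_subset by (intro holomorphic_intros) blast
      show "continuous_on (closure S) (\<lambda>s. - ?q s)"
        using nz closed by (intro continuous_intros) auto
      show "bounded S" by (auto simp: S_def intro: bounded_Int)
    qed (use fr s in \<open>auto simp: S_def\<close>)
    then show "e \<le> Re (?q s) + \<delta>" by simp
  qed
qed

text \<open>
  The bound has to be uniform: \<open>f = s + 1\<close> and \<open>p = 1\<close> have a quotient with positive real part on the
  axis, but \<open>p\<close> is of lower degree.  A uniform bound passes to infinity and keeps the leading
  coefficient from vanishing.
\<close>

lemma stable_if_Re_quotient_pos:
  assumes f: "stable_poly f" and deg: "degree p \<le> degree f" and "e > 0"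
    and axis: "\<And>\<omega>::real. Re (poly p (\<i> * \<omega>) / poly f (\<i> * \<omega>)) \<ge> e"
  shows "stable_poly p" and "degree p = degree f"
proof -
  note * = Re_quotient_lower_bound_right_half_plane[OF f deg axis]
  show "stable_poly p"
    unfolding stable_poly_def
  proof (intro allI impI)
    fix s assume "poly p s = 0"
    then show "Re s < 0" using *(2)[of s] \<open>e > 0\<close> by (cases "Re s < 0") auto
  qed
  have "coeff p (degree f) \<noteq> 0" using *(1) \<open>e > 0\<close> by auto
  then show "degree p = degree f" using deg le_degree by (meson le_antisym)
qed

section \<open>Rectangles spanned by the Kharitonov polynomials\<close>

lemma pcompose_monom_monom: "pcompose (monom c k) (monom 1 2) = monom c (2 * k)" for c :: real
  by (induction k) (simp_all add: monom_Suc pcompose_pCons mult_monom monom_0 numeral_2_eq_2)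

lemma coeff_kharitonov:
  "coeff (kharitonov d l u i k) r =
     (if d < r then 0
      else if (if even r then i = 1 else k = 1) \<longleftrightarrow> even (r div 2) then l r else u r)"
proof -
  have fin: "finite {q. 2 * q \<le> d}" "finite {q. 2 * q + 1 \<le> d}"
    by (auto intro!: finite_subset[of _ "{..d}"])
  have sum: "kharitonov d l u i k =
      (\<Sum>q | 2 * q \<le> d. monom (if i = 1 \<longleftrightarrow> even q then l (2 * q) else u (2 * q)) (2 * q)) +
      (\<Sum>q | 2 * q + 1 \<le> d. monom (if k = 1 \<longleftrightarrow> even q then l (2 * q + 1) else u (2 * q + 1)) (2 * q + 1))"
    by (simp add: kharitonov_def kh_alpha_def kh_beta_def pcompose_sum pcompose_monom_monom
        sum_distrib_left mult_monom)
  have coeff: "coeff (kharitonov d l u i k) r =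
      (\<Sum>q | 2 * q \<le> d. if 2 * q = r then if i = 1 \<longleftrightarrow> even q then l (2 * q) else u (2 * q) else 0) +
      (\<Sum>q | 2 * q + 1 \<le> d. if 2 * q + 1 = r then if k = 1 \<longleftrightarrow> even q then l (2 * q + 1) else u (2 * q + 1) else 0)"
    by (simp only: sum coeff_sum coeff_add coeff_monom)
  show ?thesis
  proof (cases "even r")
    case True
    then obtain q where "r = 2 * q" by blast
    moreover from this have "Suc (2 * q') \<noteq> r" for q' by presburger
    ultimately show ?thesis unfolding coeff using fin by simp
  next
    case False
    then obtain q where "r = Suc (2 * q)" by (auto elim: oddE)
    moreover from this have "2 * q' \<noteq> r" for q' by presburger
    ultimately show ?thesis unfolding coeff using fin by simp
  qed
qed

lemma degree_kharitonov_le: "degree (kharitonov d l u i k) \<le> d"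
  by (rule degree_le) (simp add: coeff_kharitonov)

lemma mem_interval_polys_iff:
  "p \<in> interval_polys d l u \<longleftrightarrow> degree p \<le> d \<and> (\<forall>r\<le>d. l r \<le> coeff p r \<and> coeff p r \<le> u r)"
proof
  assume "p \<in> interval_polys d l u"
  then obtain c where p: "p = (\<Sum>i\<le>d. monom (c i) i)" and c: "\<forall>i\<le>d. c i \<in> {l i..u i}"
    by (auto simp: interval_polys_def)
  have "coeff p r = (if r \<le> d then c r else 0)" for r
    by (simp add: p coeff_sum)
  then show "degree p \<le> d \<and> (\<forall>r\<le>d. l r \<le> coeff p r \<and> coeff p r \<le> u r)"
    using c by (auto intro!: degree_le)
next
  assume *: "degree p \<le> d \<and> (\<forall>r\<le>d. l r \<le> coeff p r \<and> coeff p r \<le> u r)"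
  then have "p = (\<Sum>i\<le>d. monom (coeff p i) i)" by (simp add: poly_as_sum_of_monoms')
  then show "p \<in> interval_polys d l u"
    using * unfolding interval_polys_def by (auto intro!: exI[of _ "coeff p"])
qed

lemma kharitonov_mem_interval_polys:
  assumes "\<And>r. r \<le> d \<Longrightarrow> l r \<le> u r"
  shows "kharitonov d l u i k \<in> interval_polys d l u"
  using assms by (simp add: mem_interval_polys_iff degree_kharitonov_le coeff_kharitonov)

lemma cpoly_imaginary_axis:
  assumes "degree p \<le> d"
  shows "cpoly p (\<i> * of_real \<omega>) = (\<Sum>r\<le>d. of_real (coeff p r) * (\<i> * of_real \<omega>) ^ r)"
proof -
  have "degree (cx p) \<le> d" using assms by (simp add: degree_map_poly)
  then have "cpoly p (\<i> * of_real \<omega>) = poly (\<Sum>r\<le>d. monom (coeff (cx p) r) r) (\<i> * of_real \<omega>)"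
    by (simp add: cpoly_def poly_as_sum_of_monoms')
  then show ?thesis by (simp add: poly_sum poly_monom coeff_map_poly)
qed

lemma imaginary_axis_power:
  "(\<i> * of_real \<omega>) ^ r =
     (if even r then of_real ((-1) ^ (r div 2) * \<omega> ^ r) else \<i> * of_real ((-1) ^ (r div 2) * \<omega> ^ r))"
  by (cases "even r") (auto elim!: evenE oddE simp: power_mult_distrib power_mult)

lemma imaginary_axis_term:
  "Re (of_real c * (\<i> * of_real \<omega>) ^ r) = (if even r then (-1) ^ (r div 2) * c * \<omega> ^ r else 0)"
  "Im (of_real c * (\<i> * of_real \<omega>) ^ r) = (if odd r then (-1) ^ (r div 2) * c * \<omega> ^ r else 0)"
proof -
  define x where "x = (-1) ^ (r div 2) * \<omega> ^ r"
  have pow: "(\<i> * of_real \<omega>) ^ r = (if even r then of_real x else \<i> * of_real x)"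
    unfolding x_def by (rule imaginary_axis_power)
  have x: "(-1) ^ (r div 2) * c * \<omega> ^ r = c * x" by (simp add: x_def)
  show "Re (of_real c * (\<i> * of_real \<omega>) ^ r) = (if even r then (-1) ^ (r div 2) * c * \<omega> ^ r else 0)"
    "Im (of_real c * (\<i> * of_real \<omega>) ^ r) = (if odd r then (-1) ^ (r div 2) * c * \<omega> ^ r else 0)"
    unfolding x pow by simp_all
qed

text \<open>
  On the imaginary axis \<open>s ^ r\<close> has the signs \<open>+, +, -, -\<close> (up to the factor \<open>\<i>\<close> for odd \<open>r\<close>).  This is the
  pattern in which Kharitonov polynomials choose between lower and upper coefficient bounds,
  so that every single term of the real or imaginary part is extremal.
\<close>

lemma Re_cpoly_le:
  assumes "degree p \<le> d" "degree q \<le> d"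
    and "\<And>r. r \<le> d \<Longrightarrow> even r \<Longrightarrow> (-1) ^ (r div 2) * coeff p r \<le> (-1) ^ (r div 2) * coeff q r"
  shows "Re (cpoly p (\<i> * of_real \<omega>)) \<le> Re (cpoly q (\<i> * of_real \<omega>))"
  unfolding cpoly_imaginary_axis[OF assms(1)] cpoly_imaginary_axis[OF assms(2)] Re_sum imaginary_axis_term
  using assms(3) by (auto intro!: sum_mono mult_right_mono simp: zero_le_even_power)

lemma Im_cpoly_le:
  assumes "degree p \<le> d" "degree q \<le> d" and "\<omega> \<ge> 0"
    and "\<And>r. r \<le> d \<Longrightarrow> odd r \<Longrightarrow> (-1) ^ (r div 2) * coeff p r \<le> (-1) ^ (r div 2) * coeff q r"
  shows "Im (cpoly p (\<i> * of_real \<omega>)) \<le> Im (cpoly q (\<i> * of_real \<omega>))"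
  unfolding cpoly_imaginary_axis[OF assms(1)] cpoly_imaginary_axis[OF assms(2)] Im_sum imaginary_axis_term
  using assms(3,4) by (auto intro!: sum_mono mult_right_mono)

lemma cpoly_minus_imaginary_axis: "cpoly p (\<i> * of_real (- \<omega>)) = cnj (cpoly p (\<i> * of_real \<omega>))"
  unfolding cpoly_imaginary_axis[OF order_refl] cnj_sum by simp

definition corner :: "nat \<Rightarrow> (nat \<Rightarrow> real) \<Rightarrow> (nat \<Rightarrow> real) \<Rightarrow> nat \<Rightarrow> nat \<Rightarrow> real \<Rightarrow> complex" where
  "corner d l u i k \<omega> = cpoly (kharitonov d l u i k) (\<i> * of_real \<omega>)"

definition value_box :: "nat \<Rightarrow> (nat \<Rightarrow> real) \<Rightarrow> (nat \<Rightarrow> real) \<Rightarrow> real \<Rightarrow> complex set" where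
  "value_box d l u \<omega> = cbox (corner d l u 1 1 \<omega>) (corner d l u 2 2 \<omega>)"

lemma Re_corner: "Re (corner d l u i k \<omega>) = Re (corner d l u i k' \<omega>)"
  unfolding corner_def
  by (intro antisym Re_cpoly_le[where d = d] degree_kharitonov_le) (simp_all add: coeff_kharitonov)

text \<open>
  The comparison of imaginary parts needs \<open>\<omega> \<ge> 0\<close>; negative frequencies follow by conjugation.
\<close>

lemma Im_corner: "Im (corner d l u i k \<omega>) = Im (corner d l u i' k \<omega>)"
proof -
  have pos: "Im (corner d l u i k \<omega>) = Im (corner d l u i' k \<omega>)" if "\<omega> \<ge> 0" for \<omega>
    unfolding corner_def using that
    by (intro antisym Im_cpoly_le[where d = d] degree_kharitonov_le) (simp_all add: coeff_kharitonov)
  show ?thesis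
  proof (cases "\<omega> \<ge> 0")
    case False
    then show ?thesis
      using pos[of "-\<omega>"] unfolding corner_def cpoly_minus_imaginary_axis by simp
  qed (rule pos)
qed

lemma value_in_value_box:
  assumes "p \<in> interval_polys d l u" and "\<omega> \<ge> 0"
  shows "cpoly p (\<i> * of_real \<omega>) \<in> value_box d l u \<omega>"
proof -
  have deg: "degree p \<le> d" and c: "\<And>r. r \<le> d \<Longrightarrow> l r \<le> coeff p r \<and> coeff p r \<le> u r"
    using assms(1) by (auto simp: mem_interval_polys_iff)
  then show ?thesis
    unfolding value_box_def corner_def in_cbox_complex_iff atLeastAtMost_iff using assms(2)
    by (intro conjI Re_cpoly_le[where d = d] Im_cpoly_le[where d = d] degree_kharitonov_le)
      (auto simp: coeff_kharitonov uminus_power_if)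
qed

lemma corner_eq_Complex:
  "corner d l u i k \<omega> = Complex (Re (corner d l u i 1 \<omega>)) (Im (corner d l u 1 k \<omega>))"
  by (simp add: complex_eq_iff Re_corner[of _ _ _ i k _ 1] Im_corner[of _ _ _ i k _ 1])

lemma continuous_on_corner: "continuous_on S (corner d l u i k)"
proof -
  have "continuous_on S (\<lambda>\<omega>. poly (cx (kharitonov d l u i k)) (\<i> * of_real \<omega>))"
    by (intro continuous_intros)
  then show ?thesis by (simp add: corner_def[abs_def] cpoly_def)
qed

lemma corner_eq_poly: "corner d l u i k \<omega> = poly (cx (kharitonov d l u i k)) (\<i> * of_real \<omega>)"
  by (simp add: corner_def cpoly_def)

lemma mem_value_box_iff:
  "z \<in> value_box d l u \<omega> \<longleftrightarrow>
     Re z \<in> {Re (corner d l u 1 1 \<omega>)..Re (corner d l u 2 1 \<omega>)} \<and>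
     Im z \<in> {Im (corner d l u 1 1 \<omega>)..Im (corner d l u 1 2 \<omega>)}"
  unfolding value_box_def in_cbox_complex_iff
  by (auto simp: Re_corner[of _ _ _ 2 2 _ 1] Im_corner[of _ _ _ 2 2 _ 1])

section \<open>The rectangle of the denominators omits the origin\<close>

text \<open>
  Kharitonov's theorem for the values on the imaginary axis.  By the lemma on moving edges the
  origin is never on the boundary of the rectangle.  At frequency \<open>0\<close> the rectangle is degenerate
  and consists of boundary points only, so the origin is outside, and it cannot get into the interior without crossing the boundary:
  the first frequency at which it is in the rectangle would be preceded by another one.
\<close>

lemma zero_notin_value_box:
  assumes stable: "\<And>i k. i \<in> {1, 2} \<Longrightarrow> k \<in> {1, 2} \<Longrightarrow> stable_poly (cx (kharitonov d l u i k))"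
    and deg: "\<And>i k. degree (kharitonov d l u i k) > 0"
    and "\<omega> \<ge> 0"
  shows "0 \<notin> value_box d l u \<omega>"
proof
  assume zero: "0 \<in> value_box d l u \<omega>"
  define A where "A i \<nu> = Re (corner d l u i 1 \<nu>)" for i \<nu>
  define B where "B k \<nu> = Im (corner d l u 1 k \<nu>)" for k \<nu>
  have corner: "poly (cx (kharitonov d l u i k)) (\<i> * of_real \<nu>) = Complex (A i \<nu>) (B k \<nu>)" for i k \<nu>
    using corner_eq_Complex[of d l u i k \<nu>] by (simp add: A_def B_def corner_eq_poly)
  have box: "0 \<in> value_box d l u \<nu> \<longleftrightarrow> A 1 \<nu> \<le> 0 \<and> 0 \<le> A 2 \<nu> \<and> B 1 \<nu> \<le> 0 \<and> 0 \<le> B 2 \<nu>" for \<nu>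
    by (auto simp: mem_value_box_iff A_def B_def)
  have cont: "continuous_on S (A i)" "continuous_on S (B k)" for S i k
    unfolding A_def[abs_def] B_def[abs_def] by (intro continuous_intros continuous_on_corner)+
  have deg': "degree (cx (kharitonov d l u i k)) > 0" for i k
    using deg by (simp add: degree_map_poly)
  have A: "A i \<nu> \<noteq> 0" if "i \<in> {1, 2}" "0 \<in> value_box d l u \<nu>" for i \<nu>
  proof
    assume "A i \<nu> = 0"
    show False
      by (rule moving_edge_avoids_origin[where p = "cx (kharitonov d l u i 1)" and q = "cx (kharitonov d l u i 2)"
            and d = \<i> and r = "\<lambda>\<nu>. B 2 \<nu> - B 1 \<nu>" and a = "B 1 \<nu>" and \<omega>\<^sub>0 = \<nu>])
        (use that \<open>A i \<nu> = 0\<close> in \<open>auto simp: corner box complex_eq_iff deg' intro: stable\<close>)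
  qed
  have B: "B k \<nu> \<noteq> 0" if "k \<in> {1, 2}" "0 \<in> value_box d l u \<nu>" for k \<nu>
  proof
    assume "B k \<nu> = 0"
    show False
      by (rule moving_edge_avoids_origin[where p = "cx (kharitonov d l u 1 k)" and q = "cx (kharitonov d l u 2 k)"
            and d = 1 and r = "\<lambda>\<nu>. A 2 \<nu> - A 1 \<nu>" and a = "A 1 \<nu>" and \<omega>\<^sub>0 = \<nu>])
        (use that \<open>B k \<nu> = 0\<close> in \<open>auto simp: corner box complex_eq_iff deg' intro: stable\<close>)
  qed
  define S where "S = {0..\<omega>} \<inter> {\<nu>. 0 \<in> value_box d l u \<nu>}"
  have "closed {\<nu>. 0 \<in> value_box d l u \<nu>}"
    unfolding box by (intro closed_Collect_conj closed_Collect_le cont continuous_on_const)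
  then have "compact S" unfolding S_def by (intro compact_Int_closed compact_Icc)
  moreover have "S \<noteq> {}" using zero \<open>\<omega> \<ge> 0\<close> by (auto simp: S_def)
  ultimately obtain \<nu> where \<nu>: "\<nu> \<in> S" and least: "\<And>\<nu>'. \<nu>' \<in> S \<Longrightarrow> \<nu> \<le> \<nu>'"
    using compact_attains_inf[of S] by blast
  have in_box: "0 \<in> value_box d l u \<nu>" using \<nu> by (simp add: S_def)
  then have strict: "A 1 \<nu> < 0" "0 < A 2 \<nu>" "B 1 \<nu> < 0" "0 < B 2 \<nu>"
    using A[of 1 \<nu>] A[of 2 \<nu>] B[of 1 \<nu>] B[of 2 \<nu>] box[of \<nu>] by auto
  have "B 1 0 = 0"
    by (simp add: B_def corner_def cpoly_def poly_0_coeff_0 coeff_map_poly)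
  then have "\<nu> > 0" using strict \<nu> by (cases "\<nu> = 0") (auto simp: S_def)
  have lim: "(A i \<longlongrightarrow> A i \<nu>) (at \<nu>)" "(B k \<longlongrightarrow> B k \<nu>) (at \<nu>)" for i k
    using cont[of UNIV] by (auto simp: continuous_on_def)
  have "eventually (\<lambda>\<nu>'. A 1 \<nu>' < 0 \<and> 0 < A 2 \<nu>' \<and> B 1 \<nu>' < 0 \<and> 0 < B 2 \<nu>') (at \<nu>)"
    by (intro eventually_conj order_tendstoD(1)[OF lim(1)] order_tendstoD(2)[OF lim(1)]
        order_tendstoD(1)[OF lim(2)] order_tendstoD(2)[OF lim(2)] strict)
  then have "eventually (\<lambda>\<nu>'. A 1 \<nu>' < 0 \<and> 0 < A 2 \<nu>' \<and> B 1 \<nu>' < 0 \<and> 0 < B 2 \<nu>') (at_left \<nu>)"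
    by (simp add: eventually_at_split)
  then obtain b where "b < \<nu>" and b: "\<And>\<nu>'. b < \<nu>' \<Longrightarrow> \<nu>' < \<nu> \<Longrightarrow> 0 \<in> value_box d l u \<nu>'"
    unfolding eventually_at_left_field box by (metis less_imp_le)
  obtain \<nu>' where "max b 0 < \<nu>'" "\<nu>' < \<nu>" using dense[of "max b 0" \<nu>] \<open>b < \<nu>\<close> \<open>\<nu> > 0\<close> by auto
  then show False using b[of \<nu>'] least[of \<nu>'] \<nu> by (auto simp: S_def)
qed

section \<open>Minimising the real part of a quotient over two rectangles\<close>

text \<open>
  Write \<open>c = Re z\<close>, so that the minimum of \<open>Re (g' / f')\<close> is \<open>- c\<close> and the function
  \<open>Re (g' * cnj f') + c * (cmod f')\<^sup>2\<close> is nonnegative and vanishes at \<open>(g, f)\<close>.  It is affine in \<open>g'\<close>, which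
  gives the first claim.  The second one is its derivative along the segment from \<open>f\<close> to \<open>f'\<close>, with
  \<open>g = - z * f\<close> inserted.
\<close>

lemma ratio_minimum_first_order:
  fixes f g :: complex
  assumes "convex F" and g: "g \<in> G" and f: "f \<in> F" and "0 \<notin> F"
    and min: "\<And>g' f'. g' \<in> G \<Longrightarrow> f' \<in> F \<Longrightarrow> Re (g / f) \<le> Re (g' / f')"
    and z: "g + z * f = 0"
  shows "g' \<in> G \<Longrightarrow> Re ((g' - g) * cnj f) \<ge> 0"
    and "f' \<in> F \<Longrightarrow> Re ((f' - f) * cnj (cnj z * f)) \<ge> 0"
proof -
  have "f \<noteq> 0" using f \<open>0 \<notin> F\<close> by auto
  have ratio: "Re (a / b) = Re (a * cnj b) / (cmod b)\<^sup>2" for a b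
    by (simp add: Re_divide cmod_power2)
  show "Re ((g' - g) * cnj f) \<ge> 0" if "g' \<in> G"
    using min[OF that f] \<open>f \<noteq> 0\<close> by (simp add: ratio divide_le_cancel algebra_simps)
  show "Re ((f' - f) * cnj (cnj z * f)) \<ge> 0" if "f' \<in> F"
  proof -
    define h where "h = f' - f"
    define X where "X = Re (h * cnj (cnj z * f))"
    have g_eq: "g = - z * f" using z by (simp add: eq_neg_iff_add_eq_0)
    have c: "Re (g / f) = - Re z" using \<open>f \<noteq> 0\<close> by (simp add: g_eq)
    have bound: "- (Re z * (cmod h)\<^sup>2 * \<tau>) \<le> X" if \<tau>: "0 < \<tau>" "\<tau> < 1" for \<tau> :: real
    proof -
      have "f + of_real \<tau> * h = (1 - \<tau>) *\<^sub>R f + \<tau> *\<^sub>R f'"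
        by (simp add: h_def scaleR_conv_of_real algebra_simps)
      then have mem: "f + of_real \<tau> * h \<in> F"
        using convexD_alt[OF \<open>convex F\<close> f \<open>f' \<in> F\<close>] \<tau> by simp
      then have "f + of_real \<tau> * h \<noteq> 0" using \<open>0 \<notin> F\<close> by auto
      then have pos: "(cmod (f + of_real \<tau> * h))\<^sup>2 > 0" by simp
      have "- Re z \<le> Re (g / (f + of_real \<tau> * h))"
        using min[OF g mem] c by simp
      then have "- Re z \<le> Re (- z * f * cnj (f + of_real \<tau> * h)) / (cmod (f + of_real \<tau> * h))\<^sup>2"
        unfolding ratio g_eq .
      then have "0 \<le> Re (- z * f * cnj (f + of_real \<tau> * h)) + Re z * (cmod (f + of_real \<tau> * h))\<^sup>2"
        using pos by (simp add: pos_le_divide_eq)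
      also have "\<dots> = \<tau> * (X + Re z * (cmod h)\<^sup>2 * \<tau>)"
        unfolding X_def cmod_power2 by (simp add: algebra_simps power2_eq_square)
      finally show ?thesis using \<tau> by (simp add: zero_le_mult_iff)
    qed
    have "((\<lambda>\<tau>. - (Re z * (cmod h)\<^sup>2 * \<tau>)) \<longlongrightarrow> - (Re z * (cmod h)\<^sup>2 * 0)) (at_right 0)"
      by (intro tendsto_intros)
    moreover have "eventually (\<lambda>\<tau>. - (Re z * (cmod h)\<^sup>2 * \<tau>) \<le> X) (at_right 0)"
      using bound by (auto simp: eventually_at_right_field intro!: exI[of _ 1])
    ultimately have "- (Re z * (cmod h)\<^sup>2 * 0) \<le> X"
      by (intro tendsto_upperbound) auto
    then show ?thesis by (simp add: X_def h_def)
  qed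
qed

text \<open>
  The set \<open>I3\<close> leaves out the four pairs of opposite corners.
\<close>

lemma mem_I3_iff:
  "(i, j, k, l) \<in> I3 \<longleftrightarrow> {i, j, k, l} \<subseteq> {1, 2} \<and> (i = k \<or> j = l)"
  unfolding I3_def by auto

lemma mem_I3I:
  assumes "i \<in> {1, 2}" "j \<in> {1, 2}" "k \<in> {1, 2}" "l \<in> {1, 2}" and "i = k \<or> j = l"
  shows "(i, j, k, l) \<in> I3"
  using assms by (simp add: mem_I3_iff)

text \<open>
  The heart of the argument.  It is stated for arbitrary points of the two rectangles, where
  real and imaginary parts vary independently.
\<close>

lemma Re_ratio_ge_on_value_boxes:
  fixes m n :: nat and al au bl bu :: "nat \<Rightarrow> real"
  assumes "m \<le> n" "n > 0"
    and stable: "\<And>k l. k \<in> {1, 2} \<Longrightarrow> l \<in> {1, 2} \<Longrightarrow> stable_poly (cx (kharitonov n bl bu k l))"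
    and deg: "\<And>k l. degree (kharitonov n bl bu k l) = n"
    and vertex: "\<And>i j k l \<omega>. (i, j, k, l) \<in> I3 \<Longrightarrow>
      \<gamma> \<le> Re (corner m al au i j \<omega> / corner n bl bu k l \<omega>)"
    and "\<gamma> \<le> 0" and "\<omega> \<ge> 0"
    and g0: "g0 \<in> value_box m al au \<omega>" and f0: "f0 \<in> value_box n bl bu \<omega>"
  shows "\<gamma> \<le> Re (g0 / f0)"
proof (rule ccontr)
  assume contr: "\<not> \<gamma> \<le> Re (g0 / f0)"
  let ?G = "value_box m al au \<omega>" and ?F = "value_box n bl bu \<omega>"
  have "0 \<notin> ?F"
    using zero_notin_value_box[OF stable] deg \<open>n > 0\<close> \<open>\<omega> \<ge> 0\<close> by simp
  then have "continuous_on (?G \<times> ?F) (\<lambda>(g, f). Re (g / f))"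
    unfolding case_prod_unfold by (intro continuous_intros) auto
  moreover have "compact (?G \<times> ?F)"
    unfolding value_box_def by (intro compact_Times compact_cbox)
  ultimately obtain g f where g: "g \<in> ?G" and f: "f \<in> ?F"
    and min: "\<And>g' f'. g' \<in> ?G \<Longrightarrow> f' \<in> ?F \<Longrightarrow> Re (g / f) \<le> Re (g' / f')"
    using continuous_attains_inf[of "?G \<times> ?F" "\<lambda>(g, f). Re (g / f)"] g0 f0 by fastforce
  have "f \<noteq> 0" using f \<open>0 \<notin> ?F\<close> by auto
  define z where "z = - (g / f)"
  have zero: "g + z * f = 0" using \<open>f \<noteq> 0\<close> by (simp add: z_def)
  have \<gamma>: "\<gamma> + Re z > 0" using min[OF g0 f0] contr by (simp add: z_def)
  then have "Re z > 0" using \<open>\<gamma> \<le> 0\<close> by simp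
  then have "z \<noteq> 0" by auto

  define P where "P i j k l = cx (kharitonov m al au i j) + smult z (cx (kharitonov n bl bu k l))" for i j k l
  have P: "stable_poly (P i j k l)" "degree (P i j k l) > 0" if "(i, j, k, l) \<in> I3" for i j k l
  proof -
    have fst: "stable_poly (cx (kharitonov n bl bu k l))"
      using that by (auto simp: mem_I3_iff intro: stable)
    have degf: "degree (cx (kharitonov n bl bu k l)) = n"
      using deg by (simp add: degree_map_poly)
    have "degree (cx (kharitonov m al au i j)) \<le> n"
      using degree_kharitonov_le[of m al au i j] \<open>m \<le> n\<close> by (simp add: degree_map_poly)
    then have le: "degree (P i j k l) \<le> degree (cx (kharitonov n bl bu k l))"
      unfolding P_def degf by (intro degree_add_le) (auto simp: degf)
    have "\<gamma> + Re z \<le> Re (poly (P i j k l) (\<i> * of_real \<nu>) / poly (cx (kharitonov n bl bu k l)) (\<i> * of_real \<nu>))" for \<nu>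
    proof -
      have "poly (cx (kharitonov n bl bu k l)) (\<i> * of_real \<nu>) \<noteq> 0"
        using stable_nonzero[OF fst] by simp
      then show ?thesis using vertex[OF that, of \<nu>]
        by (simp add: P_def corner_eq_poly add_divide_distrib del: Re_divide)
    qed
    from stable_if_Re_quotient_pos[OF fst le \<gamma> this] degf \<open>n > 0\<close>
    show "stable_poly (P i j k l)" "degree (P i j k l) > 0" by auto
  qed

  define A where "A i \<nu> = Re (corner m al au i 1 \<nu>)" for i \<nu>
  define B where "B j \<nu> = Im (corner m al au 1 j \<nu>)" for j \<nu>
  define C where "C k \<nu> = Re (corner n bl bu k 1 \<nu>)" for k \<nu>
  define D where "D l \<nu> = Im (corner n bl bu 1 l \<nu>)" for l \<nu>
  have corner_val: "poly (P i j k l) (\<i> * of_real \<nu>) = Complex (A i \<nu>) (B j \<nu>) + z * Complex (C k \<nu>) (D l \<nu>)" for i j k l \<nu>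
    using corner_eq_Complex[of m al au i j \<nu>] corner_eq_Complex[of n bl bu k l \<nu>]
    by (simp add: P_def A_def B_def C_def D_def corner_eq_poly)
  have corner_offset: "poly (P i j k l) (\<i> * of_real \<omega>) =
      Complex (A i \<omega> - Re g) (B j \<omega> - Im g) + z * Complex (C k \<omega> - Re f) (D l \<omega> - Im f)" for i j k l
    using zero by (simp add: corner_val complex_eq_iff algebra_simps)
  have G_iff: "g' \<in> ?G \<longleftrightarrow> A 1 \<omega> \<le> Re g' \<and> Re g' \<le> A 2 \<omega> \<and> B 1 \<omega> \<le> Im g' \<and> Im g' \<le> B 2 \<omega>" for g'
    by (auto simp: mem_value_box_iff A_def B_def)
  have F_iff: "f' \<in> ?F \<longleftrightarrow> C 1 \<omega> \<le> Re f' \<and> Re f' \<le> C 2 \<omega> \<and> D 1 \<omega> \<le> Im f' \<and> Im f' \<le> D 2 \<omega>" for f'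
    by (auto simp: mem_value_box_iff C_def D_def)

  have edge: False
    if e: "(i, j, k, l) \<in> I3" "(i', j', k', l') \<in> I3" and "d \<noteq> 0"
      and diff: "\<And>\<nu>::real. poly (P i' j' k' l') (\<i> * of_real \<nu>) = poly (P i j k l) (\<i> * of_real \<nu>) + d * of_real (r \<nu>)"
      and "poly (P i j k l) (\<i> * of_real \<omega>) = d * of_real a" "a \<le> 0" "0 \<le> a + r \<omega>"
    for i j k l i' j' k' l' d a and r :: "real \<Rightarrow> real"
    using moving_edge_avoids_origin[OF P(1)[OF e(1)] P(1)[OF e(2)] P(2)[OF e(1)] P(2)[OF e(2)]] that(3-) by blast

  \<comment> \<open>\<open>g\<close> is extremal in the direction \<open>f\<close>, and \<open>f\<close> in the direction \<open>w\<close>.\<close>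
  define w where "w = cnj z * f"
  have "convex ?F" by (simp add: value_box_def convex_box)
  note first_order = ratio_minimum_first_order[OF \<open>convex ?F\<close> g f \<open>0 \<notin> ?F\<close> min zero, folded w_def]
  have Re_w: "Re w = Re z * Re f + Im z * Im f" and Im_w: "Im w = Re z * Im f - Im z * Re f"
    by (simp_all add: w_def)
  have acute: "Re f * Re w + Im f * Im w > 0"
  proof -
    have "Re f * Re w + Im f * Im w = Re z * (cmod f)\<^sup>2"
      unfolding Re_w Im_w cmod_power2 by (simp add: power2_eq_square algebra_simps)
    then show ?thesis using \<open>Re z > 0\<close> \<open>f \<noteq> 0\<close> by simp
  qed
  \<comment> \<open>The sign of each coordinate of the two directions decides which bound is attained; a
    coordinate that vanishes leaves the corresponding part of \<open>g\<close> or \<open>f\<close> free.\<close>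
  define s where "s t = (if t > 0 then 1 else 2 :: nat)" for t :: real
  define I where "I = s (Re f)"
  define J where "J = s (Im f)"
  define K where "K = s (Re w)"
  define L where "L = s (Im w)"
  note index_defs = I_def J_def K_def L_def s_def
  have index: "I \<in> {1, 2}" "J \<in> {1, 2}" "K \<in> {1, 2}" "L \<in> {1, 2}"
    by (simp_all add: index_defs)
  have gA: "Re g = A I \<omega>" if "Re f \<noteq> 0"
    using first_order(1)[of "Complex (A I \<omega>) (Im g)"] g that
    by (auto simp: G_iff index_defs zero_le_mult_iff split: if_splits)
  have gB: "Im g = B J \<omega>" if "Im f \<noteq> 0"
    using first_order(1)[of "Complex (Re g) (B J \<omega>)"] g that
    by (auto simp: G_iff index_defs zero_le_mult_iff split: if_splits)
  have fC: "Re f = C K \<omega>" if "Re w \<noteq> 0"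
    using first_order(2)[of "Complex (C K \<omega>) (Im f)"] f that
    by (auto simp: F_iff index_defs zero_le_mult_iff split: if_splits)
  have fD: "Im f = D L \<omega>" if "Im w \<noteq> 0"
    using first_order(2)[of "Complex (Re f) (D L \<omega>)"] f that
    by (auto simp: F_iff index_defs zero_le_mult_iff split: if_splits)

  have gb: "A 1 \<omega> \<le> Re g" "Re g \<le> A 2 \<omega>" "B 1 \<omega> \<le> Im g" "Im g \<le> B 2 \<omega>"
    and fb: "C 1 \<omega> \<le> Re f" "Re f \<le> C 2 \<omega>" "D 1 \<omega> \<le> Im f" "Im f \<le> D 2 \<omega>"
    using g f by (simp_all add: G_iff F_iff)
  have le: "Re z * (x - y) \<le> 0" if "x \<le> y" for x y
    using \<open>Re z > 0\<close> that by (simp add: mult_le_0_iff)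
  have ge: "Re z * (x - y) \<ge> 0" if "y \<le> x" for x y
    using \<open>Re z > 0\<close> that by simp
  have one_two: "1 \<in> {1, 2 :: nat}" "2 \<in> {1, 2 :: nat}" by simp_all
  show False
  proof (cases "Re f = 0"; cases "Im f = 0")
    assume "Re f = 0" "Im f = 0"
    then show False using \<open>f \<noteq> 0\<close> by (simp add: complex_eq_iff)
  next
    \<comment> \<open>\<open>Re g\<close> is free.  For real \<open>z\<close> the directions \<open>f\<close> and \<open>w\<close> are parallel, \<open>Re f\<close> is free too, and
      both real parts have to be moved together.\<close>
    assume x: "Re f = 0" and y: "Im f \<noteq> 0"
    then have "Im f * Im w > 0" using acute by simp
    then have ss: "L = J" "Im w \<noteq> 0" by (auto simp: index_defs zero_less_mult_iff)
    show False
    proof (cases "Im z = 0")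
      case True
      show False
      proof (rule edge)
        show "(1, J, 1, J) \<in> I3" "(2, J, 2, J) \<in> I3"
          by (intro mem_I3I index one_two; simp)+
        show "poly (P 2 J 2 J) (\<i> * of_real \<nu>) = poly (P 1 J 1 J) (\<i> * of_real \<nu>)
            + 1 * of_real ((A 2 \<nu> - A 1 \<nu>) + Re z * (C 2 \<nu> - C 1 \<nu>))" for \<nu>
          using True by (simp add: corner_val complex_eq_iff algebra_simps)
        show "poly (P 1 J 1 J) (\<i> * of_real \<omega>) = 1 * of_real ((A 1 \<omega> - Re g) + Re z * (C 1 \<omega> - Re f))"
          using True gB[OF y] fD[OF ss(2)] ss(1) by (simp add: corner_offset complex_eq_iff)
        show "(A 1 \<omega> - Re g) + Re z * (C 1 \<omega> - Re f) \<le> 0"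
          using gb le[OF fb(1)] by linarith
        show "0 \<le> (A 1 \<omega> - Re g) + Re z * (C 1 \<omega> - Re f) + ((A 2 \<omega> - A 1 \<omega>) + Re z * (C 2 \<omega> - C 1 \<omega>))"
          using gb ge[OF fb(2)] by (simp add: algebra_simps)
      qed simp
    next
      case False
      then have "Re w \<noteq> 0" using x y by (simp add: Re_w)
      show False
      proof (rule edge)
        show "(1, J, K, J) \<in> I3" "(2, J, K, J) \<in> I3"
          by (intro mem_I3I index one_two; simp)+
        show "poly (P 2 J K J) (\<i> * of_real \<nu>) = poly (P 1 J K J) (\<i> * of_real \<nu>)
            + 1 * of_real (A 2 \<nu> - A 1 \<nu>)" for \<nu>
          by (simp add: corner_val complex_eq_iff)
        show "poly (P 1 J K J) (\<i> * of_real \<omega>) = 1 * of_real (A 1 \<omega> - Re g)"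
          using gB[OF y] fC[OF \<open>Re w \<noteq> 0\<close>] fD[OF ss(2)] ss(1) by (simp add: corner_offset complex_eq_iff)
      qed (use gb in auto)
    qed
  next
    \<comment> \<open>The same with real and imaginary parts exchanged.\<close>
    assume x: "Re f \<noteq> 0" and y: "Im f = 0"
    then have "Re f * Re w > 0" using acute by simp
    then have ss: "K = I" "Re w \<noteq> 0" by (auto simp: index_defs zero_less_mult_iff)
    show False
    proof (cases "Im z = 0")
      case True
      show False
      proof (rule edge)
        show "(I, 1, I, 1) \<in> I3" "(I, 2, I, 2) \<in> I3"
          by (intro mem_I3I index one_two; simp)+
        show "poly (P I 2 I 2) (\<i> * of_real \<nu>) = poly (P I 1 I 1) (\<i> * of_real \<nu>)
            + \<i> * of_real ((B 2 \<nu> - B 1 \<nu>) + Re z * (D 2 \<nu> - D 1 \<nu>))" for \<nu>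
          using True by (simp add: corner_val complex_eq_iff algebra_simps)
        show "poly (P I 1 I 1) (\<i> * of_real \<omega>) = \<i> * of_real ((B 1 \<omega> - Im g) + Re z * (D 1 \<omega> - Im f))"
          using True gA[OF x] fC[OF ss(2)] ss(1) by (simp add: corner_offset complex_eq_iff)
        show "(B 1 \<omega> - Im g) + Re z * (D 1 \<omega> - Im f) \<le> 0"
          using gb le[OF fb(3)] by linarith
        show "0 \<le> (B 1 \<omega> - Im g) + Re z * (D 1 \<omega> - Im f) + ((B 2 \<omega> - B 1 \<omega>) + Re z * (D 2 \<omega> - D 1 \<omega>))"
          using gb ge[OF fb(4)] by (simp add: algebra_simps)
      qed simp
    next
      case False
      then have "Im w \<noteq> 0" using x y by (simp add: Im_w)
      show False
      proof (rule edge)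
        show "(I, 1, I, L) \<in> I3" "(I, 2, I, L) \<in> I3"
          by (intro mem_I3I index one_two; simp)+
        show "poly (P I 2 I L) (\<i> * of_real \<nu>) = poly (P I 1 I L) (\<i> * of_real \<nu>)
            + \<i> * of_real (B 2 \<nu> - B 1 \<nu>)" for \<nu>
          by (simp add: corner_val complex_eq_iff)
        show "poly (P I 1 I L) (\<i> * of_real \<omega>) = \<i> * of_real (B 1 \<omega> - Im g)"
          using gA[OF x] fC[OF ss(2)] fD[OF \<open>Im w \<noteq> 0\<close>] ss(1) by (simp add: corner_offset complex_eq_iff)
      qed (use gb in auto)
    qed
  next
    \<comment> \<open>\<open>g\<close> is a corner.  A vanishing coordinate of \<open>w\<close> puts \<open>f\<close> on an edge, which multiplication by \<open>z\<close>
      turns into the direction \<open>z\<close> or \<open>z * \<i>\<close>.\<close>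
    assume x: "Re f \<noteq> 0" and y: "Im f \<noteq> 0"
    show False
    proof (cases "Re w = 0"; cases "Im w = 0")
      assume "Re w = 0" "Im w = 0"
      then show False using acute by simp
    next
      assume "Re w = 0" and nz: "Im w \<noteq> 0"
      then have ss: "L = J" using acute by (auto simp: index_defs zero_less_mult_iff)
      show False
      proof (rule edge)
        show "(I, J, 1, J) \<in> I3" "(I, J, 2, J) \<in> I3"
          by (intro mem_I3I index one_two; simp)+
        show "poly (P I J 2 J) (\<i> * of_real \<nu>) = poly (P I J 1 J) (\<i> * of_real \<nu>) + z * of_real (C 2 \<nu> - C 1 \<nu>)" for \<nu>
          by (simp add: corner_val complex_eq_iff algebra_simps)
        show "poly (P I J 1 J) (\<i> * of_real \<omega>) = z * of_real (C 1 \<omega> - Re f)"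
          using gA[OF x] gB[OF y] fD[OF nz] ss by (simp add: corner_offset complex_eq_iff)
      qed (use fb \<open>z \<noteq> 0\<close> in auto)
    next
      assume nz: "Re w \<noteq> 0" and "Im w = 0"
      then have ss: "K = I" using acute by (auto simp: index_defs zero_less_mult_iff)
      show False
      proof (rule edge)
        show "(I, J, I, 1) \<in> I3" "(I, J, I, 2) \<in> I3"
          by (intro mem_I3I index one_two; simp)+
        show "poly (P I J I 2) (\<i> * of_real \<nu>) = poly (P I J I 1) (\<i> * of_real \<nu>) + (z * \<i>) * of_real (D 2 \<nu> - D 1 \<nu>)" for \<nu>
          by (simp add: corner_val complex_eq_iff algebra_simps)
        show "poly (P I J I 1) (\<i> * of_real \<omega>) = (z * \<i>) * of_real (D 1 \<omega> - Im f)"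
          using gA[OF x] gB[OF y] fC[OF nz] ss by (simp add: corner_offset complex_eq_iff)
      qed (use fb \<open>z \<noteq> 0\<close> in auto)
    next
      assume nz: "Re w \<noteq> 0" "Im w \<noteq> 0"
      have "Re f * Re w > 0 \<or> Im f * Im w > 0" using acute by linarith
      then have "I = K \<or> J = L" by (auto simp: index_defs zero_less_mult_iff)
      then have "(I, J, K, L) \<in> I3" by (intro mem_I3I index)
      then have "poly (P I J K L) (\<i> * of_real \<omega>) \<noteq> 0"
        using stable_nonzero[OF P(1)] by simp
      moreover have "poly (P I J K L) (\<i> * of_real \<omega>) = 0"
        using gA[OF x] gB[OF y] fC[OF nz(1)] fD[OF nz(2)] by (simp add: corner_offset complex_eq_iff)
      ultimately show False by simp
    qed
  qed
qed

section \<open>Comparing the two infima\<close>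

lemma gamma0_eq_Min_image:
  "gamma0 m n al au bl bu =
     Min ((\<lambda>(i, j, k, l). inf_Re (kharitonov m al au i j) (kharitonov n bl bu k l)) ` I3)"
  unfolding gamma0_def by (rule arg_cong[where f = Min]) force

lemma finite_I3: "finite I3" and I3_nonempty: "I3 \<noteq> {}"
  by (simp_all add: I3_def)

lemma gamma0_le_vertex:
  assumes "(i, j, k, l) \<in> I3"
  shows "gamma0 m n al au bl bu \<le> ereal (Re (corner m al au i j \<omega> / corner n bl bu k l \<omega>))"
proof -
  have "gamma0 m n al au bl bu \<le> inf_Re (kharitonov m al au i j) (kharitonov n bl bu k l)"
    unfolding gamma0_eq_Min_image using assms by (intro Min_le) (auto simp: finite_I3 image_iff intro!: bexI[OF _ assms])
  also have "\<dots> \<le> ereal (Re (corner m al au i j \<omega> / corner n bl bu k l \<omega>))"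
    unfolding inf_Re_def corner_def by (rule INF_lower) simp
  finally show ?thesis .
qed

lemma gamma1_le_gamma0:
  assumes "\<And>i. i \<le> m \<Longrightarrow> al i \<le> au i" and "\<And>i. i \<le> n \<Longrightarrow> bl i \<le> bu i"
  shows "gamma1 m n al au bl bu \<le> gamma0 m n al au bl bu"
proof -
  have "gamma0 m n al au bl bu \<in>
      (\<lambda>(i, j, k, l). inf_Re (kharitonov m al au i j) (kharitonov n bl bu k l)) ` I3"
    unfolding gamma0_eq_Min_image by (intro Min_in) (simp_all add: finite_I3 I3_nonempty)
  then obtain i j k l where "gamma0 m n al au bl bu = inf_Re (kharitonov m al au i j) (kharitonov n bl bu k l)"
    by auto
  then show ?thesis
    unfolding gamma1_def using assms
    by (auto intro!: Inf_lower kharitonov_mem_interval_polys)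
qed

text \<open>
  The case of constant polynomials.  For \<open>\<gamma> \<le> 0\<close> the extreme ratio pairs the lower bounds if the
  denominators are positive and the upper bounds if they are negative.
\<close>

lemma interval_ratio_ge:
  fixes a b \<gamma> :: real
  assumes "\<gamma> \<le> 0" and "a1 \<le> a" "a \<le> a2" and "b1 \<le> b" "b \<le> b2" and "0 \<notin> {b1..b2}"
    and "\<gamma> \<le> a1 / b1" and "\<gamma> \<le> a2 / b2"
  shows "\<gamma> \<le> a / b"
proof (cases "b1 > 0")
  case True
  then have "\<gamma> * b1 \<le> a1" using assms(7) by (simp add: pos_le_divide_eq)
  moreover have "\<gamma> * b \<le> \<gamma> * b1" using assms(1,4) by (simp add: mult_left_mono_neg)
  ultimately have "\<gamma> * b \<le> a" using assms(2) by linarith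
  then show ?thesis using True assms(4) by (simp add: pos_le_divide_eq)
next
  case False
  then have "b2 < 0" using assms(4-6) by auto
  then have "a2 \<le> \<gamma> * b2" using assms(8) by (simp add: neg_le_divide_eq)
  moreover have "\<gamma> * b2 \<le> \<gamma> * b" using assms(1,5) by (simp add: mult_left_mono_neg)
  ultimately have "a \<le> \<gamma> * b" using assms(3) by linarith
  then show ?thesis using \<open>b2 < 0\<close> assms(5) by (simp add: neg_le_divide_eq)
qed

lemma cpoly_degree_0: "degree p = 0 \<Longrightarrow> cpoly p s = of_real (coeff p 0)"
  by (auto simp: cpoly_def map_poly_pCons elim!: degree_eq_zeroE)

lemma corner_degree_0:
  "corner 0 l u 1 1 \<omega> = of_real (l 0)" "corner 0 l u 2 2 \<omega> = of_real (u 0)"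
  using degree_kharitonov_le[of 0 l u] by (simp_all add: corner_def cpoly_degree_0 coeff_kharitonov)

theorem theorem4:
  fixes m n :: nat and al au bl bu :: "nat \<Rightarrow> real"
  assumes "m \<le> n"
    and "\<And>i. i \<le> m \<Longrightarrow> al i \<le> au i"
    and "\<And>i. i \<le> n \<Longrightarrow> bl i \<le> bu i"
    and "0 \<notin> {bl n..bu n}"
    and "\<And>i k. i \<in> {1, 2} \<Longrightarrow> k \<in> {1, 2} \<Longrightarrow> hurwitz (kharitonov n bl bu i k)"
  shows "(gamma0 m n al au bl bu < 0 \<longrightarrow>
            gamma1 m n al au bl bu = gamma0 m n al au bl bu \<and> gamma0 m n al au bl bu < 0) \<and>
         (gamma0 m n al au bl bu = 0 \<longrightarrow> gamma1 m n al au bl bu = 0) \<and>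
         (gamma0 m n al au bl bu > 0 \<longrightarrow> gamma1 m n al au bl bu \<ge> 0)"
proof -
  have stable: "stable_poly (cx (kharitonov n bl bu k l))" if "k \<in> {1, 2}" "l \<in> {1, 2}" for k l
    using assms(5)[OF that] by (simp add: hurwitz_def stable_poly_def cpoly_def)
  have "coeff (kharitonov n bl bu k l) n \<noteq> 0" for k l
    using assms(3)[of n] assms(4) by (auto simp: coeff_kharitonov)
  then have deg: "degree (kharitonov n bl bu k l) = n" for k l
    using le_degree degree_kharitonov_le by (meson le_antisym)
  \<comment> \<open>A real \<open>\<gamma>\<close> suffices: if \<open>\<gamma>\<^sub>0 = - \<infinity>\<close>, then \<open>\<gamma>\<^sub>1 \<le> \<gamma>\<^sub>0\<close> already is an equality.\<close>
  have lower: "ereal \<gamma> \<le> gamma1 m n al au bl bu"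
    if "\<gamma> \<le> 0" and "ereal \<gamma> \<le> gamma0 m n al au bl bu" for \<gamma>
  proof -
    have vertex: "\<gamma> \<le> Re (corner m al au i j \<omega> / corner n bl bu k l \<omega>)" if "(i, j, k, l) \<in> I3" for i j k l \<omega>
      using order_trans[OF \<open>ereal \<gamma> \<le> _\<close> gamma0_le_vertex[OF that]] by simp
    have nonneg: "\<gamma> \<le> Re (cpoly g (\<i> * of_real \<omega>) / cpoly f (\<i> * of_real \<omega>))"
      if g: "g \<in> interval_polys m al au" and f: "f \<in> interval_polys n bl bu" and "\<omega> \<ge> 0" for g f \<omega>
    proof (cases "n = 0")
      case True
      have "\<gamma> \<le> coeff g 0 / coeff f 0"
      proof (rule interval_ratio_ge)
        show "\<gamma> \<le> al 0 / bl 0" "\<gamma> \<le> au 0 / bu 0"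
          using vertex[of 1 1 1 1 0] vertex[of 2 2 2 2 0] True \<open>m \<le> n\<close>
          by (simp_all add: I3_def corner_degree_0[simplified] flip: of_real_divide)
      qed (use g f True \<open>m \<le> n\<close> \<open>\<gamma> \<le> 0\<close> assms(4) in \<open>auto simp: mem_interval_polys_iff\<close>)
      then show ?thesis
        using g f True \<open>m \<le> n\<close> by (simp add: mem_interval_polys_iff cpoly_degree_0)
    next
      case False
      then have "n > 0" by simp
      show ?thesis
        by (rule Re_ratio_ge_on_value_boxes[OF assms(1) \<open>n > 0\<close> stable deg vertex \<open>\<gamma> \<le> 0\<close> \<open>\<omega> \<ge> 0\<close>
              value_in_value_box[OF g \<open>\<omega> \<ge> 0\<close>] value_in_value_box[OF f \<open>\<omega> \<ge> 0\<close>]])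
    qed
    have "\<gamma> \<le> Re (cpoly g (\<i> * of_real \<omega>) / cpoly f (\<i> * of_real \<omega>))"
      if gf: "g \<in> interval_polys m al au" "f \<in> interval_polys n bl bu" for g f \<omega>
    proof (cases "\<omega> \<ge> 0")
      case False
      have "\<gamma> \<le> Re (cnj (cpoly g (\<i> * of_real \<omega>)) / cnj (cpoly f (\<i> * of_real \<omega>)))"
        using nonneg[OF gf, of "- \<omega>"] False unfolding cpoly_minus_imaginary_axis by simp
      then show ?thesis by (simp only: complex_cnj_divide[symmetric] cnj.simps)
    qed (rule nonneg[OF gf])
    then show ?thesis
      unfolding gamma1_def inf_Re_def by (auto intro!: Inf_greatest INF_greatest)
  qed
  have upper: "gamma1 m n al au bl bu \<le> gamma0 m n al au bl bu"
    using assms(2,3) by (rule gamma1_le_gamma0)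
  show ?thesis
  proof (cases "gamma0 m n al au bl bu < 0")
    case True
    then have "gamma1 m n al au bl bu = gamma0 m n al au bl bu"
      using upper lower by (cases "gamma0 m n al au bl bu") (auto intro: antisym)
    then show ?thesis using True by auto
  next
    case False
    then have "0 \<le> gamma1 m n al au bl bu" using lower[of 0] by (simp add: zero_ereal_def not_less)
    then show ?thesis using False upper by auto
  qed
qed

end
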